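(* Let $E$ be a row-finite graph and let $F$ be an explosion of $E$ (at some vertex $v$). Then the path groupoids $\mathcal{G}_E$ and $\mathcal{G}_F$ are isomorphic as topological groupoids.
   Context: Graphs. A directed graph $E$ consists of a vertex set $E^0$, an edge set $E^1$ and source and range maps $s,r:E^1\to E^0$. Throughout, "graph" means a countable directed graph without multiple edges (at most one edge from $v$ to $w$ for each ordered pair $(v,w)$; loops allowed) which is connected (any two vertices are joined by an undirected path). $E$ is row-finite if every vertex is the source of only finitely many edges. Explosion. Let $v\in E^0$ with $|s^{-1}(v)|>1$ and write $s^{-1}(v)=M_1\cup M_2$ with $M_1,M_2$ disjoint and nonempty. The (vertex) explosion $F$ of $E$ at $v$ with respect to this decomposition has vertex set $F^0=(E^0\setminus\{v\})\cup\{v',v''\}$ and the following edges: all edges of $E$ with neither source nor range equal to $v$; for each edge of $E$ from a vertex $u\ne v$ to $v$, one edge from $u$ to $v'$ and one from $u$ to $v''$; for each edge in $M_1$ from $v$ to $w\neq v$, an edge from $v'$ to $w$; for each edge in $M_2$ from $v$ to $w\ne v$, an edge from $v''$ to $w$; if the loop at $v$ exists and lies in $M_1$, a loop at $v'$ and an edge from $v'$ to $v''$; if it lies in $M_2$, a loop at $v''$ and an edge from $v''$ to $v'$. (The edge explosion at an edge $e$ with source $v$ is the case $M_1=\{e\}$.) Path groupoid. $E^*$ denotes the set of finite paths (including vertices as paths of length $0$), $E^\infty$ the set of infinite paths $x=x_1x_2\cdots$; $|\alpha|$ is the length of $\alpha\in E^*$. For $x,y\in E^\infty$, $k\in\mathbf{Z}$,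 write $x\sim_k y$ if $x_i=y_{i-k}$ for all large $i$. Then $\mathcal{G}_E=\{(x,k,y):x\sim_k y\}$ with $(x,k,y)^{-1}=(y,-k,x)$ and $(x,k,y)(y,l,z)=(x,k+l,z)$, with the topology generated by the sets $Z(\alpha,\beta)=\{(\alpha x,|\alpha|-|\beta|,\beta x): x\in E^\infty,\ s(x)=r(\alpha)\}$ for $\alpha,\beta\in E^*$ with $r(\alpha)=r(\beta)$. *)

theory Defs
  imports
    "HOL-Analysis.Analysis"
    "HOL-Library.Stream"
    "Graph_Theory.Graph_Theory"
begin

section \<open>Graphs\<close>

text \<open>
  A graph is a countable, weakly connected digraph without parallel arcs; loops are allowed.
  The source and range maps are the fields \<^const>\<open>tail\<close> and \<^const>\<open>head\<close> of the
  record type of digraphs, so \<open>out_arcs E v\<close> is the set of edges with source \<open>v\<close>.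
  The constant \<^const>\<open>Digraph_Component.connected\<close> refers to undirected paths.
\<close>

locale countable_connected_graph = nomulti_digraph E
  for E :: "('a, 'b) pre_digraph" (structure) +
  assumes countable_verts: "countable (verts E)"
    and countable_arcs: "countable (arcs E)"
    and connected: "Digraph_Component.connected E"

definition row_finite :: "('a, 'b) pre_digraph \<Rightarrow> bool" where
  "row_finite E \<longleftrightarrow> (\<forall>u \<in> verts E. finite (out_arcs E u))"


section \<open>Explosions\<close>

text \<open>The vertices \<open>v'\<close> and \<open>v''\<close> replacing the exploded vertex are \<open>Copy1\<close> and \<open>Copy2\<close>.\<close>

datatype 'a exploded_vertex = Old 'a | Copy1 | Copy2

text \<open>
  An edge of the explosion is a triple consisting of its source, the edge of \<open>E\<close> it comes
  from, and its range. The loop at \<open>v\<close>, if there is one, comes in through the last two sets.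
\<close>

definition explosion ::
  "('a, 'b) pre_digraph \<Rightarrow> 'a \<Rightarrow> 'b set \<Rightarrow> 'b set \<Rightarrow>
    ('a exploded_vertex, 'a exploded_vertex \<times> 'b \<times> 'a exploded_vertex) pre_digraph" where
  "explosion E v M1 M2 =
    \<lparr> verts = Old ` (verts E - {v}) \<union> {Copy1, Copy2},
      arcs =
          {(Old (tail E e), e, Old (head E e)) | e. e \<in> arcs E \<and> tail E e \<noteq> v \<and> head E e \<noteq> v}
        \<union> {(Old (tail E e), e, Copy1) | e. e \<in> arcs E \<and> tail E e \<noteq> v \<and> head E e = v}
        \<union> {(Old (tail E e), e, Copy2) | e. e \<in> arcs E \<and> tail E e \<noteq> v \<and> head E e = v}
        \<union> {(Copy1, e, Old (head E e)) | e. e \<in> M1 \<and> head E e \<noteq> v}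
        \<union> {(Copy2, e, Old (head E e)) | e. e \<in> M2 \<and> head E e \<noteq> v}
        \<union> {(Copy1, e, w) | e w. e \<in> M1 \<and> head E e = v \<and> w \<in> {Copy1, Copy2}}
        \<union> {(Copy2, e, w) | e w. e \<in> M2 \<and> head E e = v \<and> w \<in> {Copy1, Copy2}},
      tail = (\<lambda>(u, e, w). u),
      head = (\<lambda>(u, e, w). w) \<rparr>"

lemma nomulti_digraph_explosion:
  assumes "nomulti_digraph E" "M1 \<union> M2 = out_arcs E v" "M1 \<inter> M2 = {}"
  shows "nomulti_digraph (explosion E v M1 M2)"
proof -
  interpret nomulti_digraph E by fact
  have M: "e \<in> arcs E \<and> tail E e = v" if "e \<in> M1 \<or> e \<in> M2" for e
    using assms(2) that by (auto simp: out_arcs_def)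
  show ?thesis
  proof
    fix e assume "e \<in> arcs (explosion E v M1 M2)"
    then show "tail (explosion E v M1 M2) e \<in> verts (explosion E v M1 M2)"
      and "head (explosion E v M1 M2) e \<in> verts (explosion E v M1 M2)"
      using M by (auto simp: explosion_def)
  next
    fix e f
    assume "e \<in> arcs (explosion E v M1 M2)" "f \<in> arcs (explosion E v M1 M2)"
      "arc_to_ends (explosion E v M1 M2) e = arc_to_ends (explosion E v M1 M2) f"
    then show "e = f"
      using M by (auto simp: explosion_def arc_to_ends_def intro!: no_multi_arcs)
  qed
qed


section \<open>Topological groupoids and their isomorphisms\<close>

text \<open>
  A groupoid is given by its set of arrows; multiplication is only meaningful on the set
  of composable pairs, and inversion only on the arrows.
\<close>

record 'g top_groupoid =
  arrows :: "'g set"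
  composable :: "('g \<times> 'g) set"
  gmult :: "'g \<Rightarrow> 'g \<Rightarrow> 'g"
  ginv :: "'g \<Rightarrow> 'g"
  gtopology :: "'g topology"

definition top_groupoid_isomorphism ::
  "'g top_groupoid \<Rightarrow> 'h top_groupoid \<Rightarrow> ('g \<Rightarrow> 'h) \<Rightarrow> bool" where
  "top_groupoid_isomorphism G H \<phi> \<longleftrightarrow>
     bij_betw \<phi> (arrows G) (arrows H) \<and>
     (\<forall>a \<in> arrows G. \<forall>b \<in> arrows G. (a, b) \<in> composable G \<longleftrightarrow> (\<phi> a, \<phi> b) \<in> composable H) \<and>
     (\<forall>(a, b) \<in> composable G. \<phi> (gmult G a b) = gmult H (\<phi> a) (\<phi> b)) \<and>
     (\<forall>a \<in> arrows G. \<phi> (ginv G a) = ginv H (\<phi> a)) \<and>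
     homeomorphic_map (gtopology G) (gtopology H) \<phi>"

definition isomorphic_top_groupoids :: "'g top_groupoid \<Rightarrow> 'h top_groupoid \<Rightarrow> bool" where
  "isomorphic_top_groupoids G H \<longleftrightarrow> (\<exists>\<phi>. top_groupoid_isomorphism G H \<phi>)"


section \<open>The path groupoid\<close>

text \<open>
  A finite path is a pair of its source and its list of edges, so that the vertices are the
  paths \<open>(u, [])\<close>.
\<close>

definition finite_paths :: "('a, 'b) pre_digraph \<Rightarrow> ('a \<times> 'b awalk) set" where
  "finite_paths E = {(u, p). \<exists>w. pre_digraph.awalk E u p w}"

definition path_range :: "('a, 'b) pre_digraph \<Rightarrow> 'a \<times> 'b awalk \<Rightarrow> 'a" where
  "path_range E = (\<lambda>(u, p). pre_digraph.awlast E u p)"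

definition path_length :: "'a \<times> 'b awalk \<Rightarrow> nat" where
  "path_length = (\<lambda>(u, p). length p)"

definition infinite_paths :: "('a, 'b) pre_digraph \<Rightarrow> 'b stream set" where
  "infinite_paths E =
    {x. \<forall>i. x !! i \<in> arcs E \<and> head E (x !! i) = tail E (x !! Suc i)}"

text \<open>
  Streams are indexed from 0; this shifts the indices on both sides of
  \<open>x\<^sub>i = y\<^sub>i\<^sub>-\<^sub>k\<close> alike and does not change the relation. For large \<open>i\<close>,
  the conversion to natural numbers does not truncate.
\<close>

definition lag_equiv :: "'b stream \<Rightarrow> int \<Rightarrow> 'b stream \<Rightarrow> bool" where
  "lag_equiv x k y \<longleftrightarrow> (\<forall>\<^sub>F i in sequentially. x !! i = y !! nat (int i - k))"

definition cylinder ::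
  "('a, 'b) pre_digraph \<Rightarrow> 'a \<times> 'b awalk \<Rightarrow> 'a \<times> 'b awalk \<Rightarrow> ('b stream \<times> int \<times> 'b stream) set"
  where
  "cylinder E \<alpha> \<beta> =
    {(snd \<alpha> @- x, int (path_length \<alpha>) - int (path_length \<beta>), snd \<beta> @- x) | x.
       x \<in> infinite_paths E \<and> tail E (shd x) = path_range E \<alpha>}"

definition path_groupoid ::
  "('a, 'b) pre_digraph \<Rightarrow> ('b stream \<times> int \<times> 'b stream) top_groupoid" where
  "path_groupoid E =
    (let A = {(x, k, y). x \<in> infinite_paths E \<and> y \<in> infinite_paths E \<and> lag_equiv x k y}
     in \<lparr> arrows = A,
          composable = {((x, k, y), (y', l, z)) | x k y y' l z.
                          (x, k, y) \<in> A \<and> (y', l, z) \<in> A \<and> y = y'},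
          gmult = (\<lambda>(x, k, y) (y', l, z). (x, k + l, z)),
          ginv = (\<lambda>(x, k, y). (y, - k, x)),
          gtopology = topology_generated_by
            {cylinder E \<alpha> \<beta> | \<alpha> \<beta>. \<alpha> \<in> finite_paths E \<and> \<beta> \<in> finite_paths E \<and>
               path_range E \<alpha> = path_range E \<beta>} \<rparr>)"

text \<open>The cylinder sets cover exactly the arrows, so the topology lives on the arrow set.\<close>

lemma infinite_paths_iff:
  "x \<in> infinite_paths E \<longleftrightarrow>
    shd x \<in> arcs E \<and> head E (shd x) = tail E (shd (stl x)) \<and> stl x \<in> infinite_paths E"
proof
  assume x: "x \<in> infinite_paths E"
  then have *: "x !! i \<in> arcs E \<and> head E (x !! i) = tail E (x !! Suc i)" for i
    by (simp add: infinite_paths_def)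
  have "stl x \<in> infinite_paths E"
    using *[of "Suc i" for i] by (simp add: infinite_paths_def)
  then show "shd x \<in> arcs E \<and> head E (shd x) = tail E (shd (stl x)) \<and> stl x \<in> infinite_paths E"
    using *[of 0] by simp
next
  assume a: "shd x \<in> arcs E \<and> head E (shd x) = tail E (shd (stl x)) \<and> stl x \<in> infinite_paths E"
  have "x !! i \<in> arcs E \<and> head E (x !! i) = tail E (x !! Suc i)" for i
    using a by (cases i) (auto simp: infinite_paths_def)
  then show "x \<in> infinite_paths E"
    by (simp add: infinite_paths_def)
qed

lemma shift_infinite_path:
  assumes "wf_digraph E" "x \<in> infinite_paths E"
    and "pre_digraph.awalk E u p (tail E (shd x))"
  shows "p @- x \<in> infinite_paths E"
  using assms(3)
proof (induction p arbitrary: u)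
  case Nil
  then show ?case using assms by simp
next
  case (Cons e p)
  interpret wf_digraph E by fact
  from Cons.prems have e: "e \<in> arcs E" and p: "awalk (head E e) p (tail E (shd x))"
    by (auto simp: awalk_Cons_iff)
  have "tail E (shd (p @- x)) = head E e"
    using p by (cases p) (auto simp: awalk_def)
  then show ?case
    using Cons.IH[OF p] e by (subst infinite_paths_iff) auto
qed

lemma stake_awalk:
  assumes "wf_digraph E" "x \<in> infinite_paths E"
  shows "pre_digraph.awalk E (tail E (shd x)) (stake n x) (tail E (shd (sdrop n x)))"
  using assms(2)
proof (induction n arbitrary: x)
  interpret wf_digraph E by fact
  case 0
  then show ?case using infinite_paths_iff[of x E] by (auto simp: awalk_def)
next
  interpret wf_digraph E by fact
  case (Suc n)
  then show ?case using infinite_paths_iff[of x E] by (auto simp: awalk_Cons_iff)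
qed

lemma sdrop_infinite_path:
  "x \<in> infinite_paths E \<Longrightarrow> sdrop n x \<in> infinite_paths E"
  by (auto simp: infinite_paths_def sdrop_snth simp flip: add_Suc_right)

lemma topspace_path_groupoid:
  assumes "wf_digraph E"
  shows "topspace (gtopology (path_groupoid E)) = arrows (path_groupoid E)"
proof -
  interpret wf_digraph E by fact
  let ?A = "{(x, k, y). x \<in> infinite_paths E \<and> y \<in> infinite_paths E \<and> lag_equiv x k y}"
  let ?B = "{cylinder E \<alpha> \<beta> | \<alpha> \<beta>. \<alpha> \<in> finite_paths E \<and> \<beta> \<in> finite_paths E \<and>
               path_range E \<alpha> = path_range E \<beta>}"
  have rng: "path_range E (u, p) = w" if "awalk u p w" for u p w
    using that by (auto simp: path_range_def)
  have "\<Union> ?B = ?A"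
  proof (intro equalityI subsetI)
    fix g assume "g \<in> \<Union> ?B"
    then obtain u p u' q w where w: "awalk u p w" "awalk u' q w"
      and "g \<in> cylinder E (u, p) (u', q)"
      by (auto simp: finite_paths_def rng)
    then obtain x where x: "x \<in> infinite_paths E" "tail E (shd x) = w"
      and g: "g = (p @- x, int (length p) - int (length q), q @- x)"
      by (auto simp: cylinder_def path_length_def rng)
    have "lag_equiv (p @- x) (int (length p) - int (length q)) (q @- x)"
      unfolding lag_equiv_def eventually_sequentially
    proof (intro exI allI impI)
      fix i assume "length p \<le> i"
      then obtain j where "i = length p + j" using le_Suc_ex by blast
      moreover from this
      have "nat (int i - (int (length p) - int (length q))) = length q + j" by simp
      ultimately show "(p @- x) !! i
          = (q @- x) !! nat (int i - (int (length p) - int (length q)))"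
        by (simp add: shift_snth_ge)
    qed
    then show "g \<in> ?A"
      using shift_infinite_path[OF assms x(1)] w x g by auto
  next
    fix g assume "g \<in> ?A"
    then obtain x k y where g: "g = (x, k, y)" and x: "x \<in> infinite_paths E"
      and y: "y \<in> infinite_paths E" and "lag_equiv x k y" by auto
    then obtain N where N: "\<And>i. i \<ge> N \<Longrightarrow> x !! i = y !! nat (int i - k)"
      by (auto simp: lag_equiv_def eventually_sequentially)
    define n where "n = max N (nat k)"
    define m where "m = nat (int n - k)"
    have nm: "int n - int m = k" by (auto simp: n_def m_def)
    have z: "sdrop n x = sdrop m y"
    proof (rule stream.coinduct_strong[of "\<lambda>a b. \<exists>j. a = sdrop (n + j) x \<and> b = sdrop (m + j) y"])
      show "\<exists>j. sdrop n x = sdrop (n + j) x \<and> sdrop m y = sdrop (m + j) y"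
        by (intro exI[of _ 0]) simp
    next
      fix a b assume "\<exists>j. a = sdrop (n + j) x \<and> b = sdrop (m + j) y"
      then obtain j where j: "a = sdrop (n + j) x" "b = sdrop (m + j) y" by blast
      have "nat (int (n + j) - k) = m + j" using nm by simp
      then have "x !! (n + j) = y !! (m + j)"
        using N[of "n + j"] by (simp add: n_def)
      then show "shd a = shd b \<and>
          ((\<exists>j. stl a = sdrop (n + j) x \<and> stl b = sdrop (m + j) y) \<or> stl a = stl b)"
        using j by (auto simp: sdrop_simps intro!: exI[of _ "Suc j"])
    qed
    let ?\<alpha> = "(tail E (shd x), stake n x)" and ?\<beta> = "(tail E (shd y), stake m y)"
    have ax: "awalk (tail E (shd x)) (stake n x) (tail E (shd (sdrop n x)))"
      and ay: "awalk (tail E (shd y)) (stake m y) (tail E (shd (sdrop n x)))"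
      using stake_awalk[OF assms] x y z by metis+
    have "?\<alpha> \<in> finite_paths E" "?\<beta> \<in> finite_paths E" "path_range E ?\<alpha> = path_range E ?\<beta>"
      using ax ay rng by (auto simp: finite_paths_def)
    moreover have "g \<in> cylinder E ?\<alpha> ?\<beta>"
      unfolding cylinder_def mem_Collect_eq g
      using nm sdrop_infinite_path[OF x, of n] rng[OF ax] z stake_sdrop[of n x] stake_sdrop[of m y]
      by (intro exI[of _ "sdrop n x"]) (auto simp: path_length_def)
    ultimately show "g \<in> \<Union> ?B" by blast
  qed
  then show ?thesis
    by (simp add: path_groupoid_def Let_def topology_generated_by_topspace)
qed

end

theory Submission
  imports Defs
begin

text \<open>
  An edge of the explosion remembers the edge of \<open>E\<close> it comes from, and the copy of \<open>v\<close> at which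
  an infinite path of the explosion passes is forced by the next edge of \<open>E\<close>. Hence forgetting
  the copies is a bijection on infinite paths. It commutes with the shift, and both it and its
  inverse are sliding block codes: the \<open>i\<close>-th edge of the image depends only on the \<open>i\<close>-th and
  \<open>Suc i\<close>-th edges. Any such code between infinite path spaces induces a continuous
  homomorphism of path groupoids.
\<close>

section \<open>Neighbourhoods in the path groupoid\<close>

lemma snth_equalityI: "(\<And>i. x !! i = y !! i) \<Longrightarrow> x = y"
  by (coinduction arbitrary: x y) (metis snth.simps)

lemma stake_eq_iff: "stake n x = stake n y \<longleftrightarrow> (\<forall>i<n. x !! i = y !! i)"
  by (simp add: list_eq_iff_nth_eq)

lemma sdrop_eq_iff: "sdrop n x = sdrop m y \<longleftrightarrow> (\<forall>i. x !! (n + i) = y !! (m + i))"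
proof
  assume "sdrop n x = sdrop m y"
  then show "\<forall>i. x !! (n + i) = y !! (m + i)"
    by (metis add.commute sdrop_snth)
next
  assume "\<forall>i. x !! (n + i) = y !! (m + i)"
  then show "sdrop n x = sdrop m y"
    by (intro snth_equalityI) (simp add: sdrop_snth add.commute)
qed

text \<open>Equal tails stay equal when both cut points move on by the same amount, so the cuts may
  be taken beyond any bound \<open>N\<close>. This freedom is what the continuity proof uses; it
  also removes the truncating \<open>nat\<close> from all later arguments.\<close>

lemma lag_equiv_iff_sdrop:
  "lag_equiv x k y \<longleftrightarrow> (\<exists>n m. n \<ge> N \<and> m \<ge> N \<and> k = int n - int m \<and> sdrop n x = sdrop m y)"
proof
  assume "lag_equiv x k y"
  then obtain K where K: "\<And>i. i \<ge> K \<Longrightarrow> x !! i = y !! nat (int i - k)"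
    by (auto simp: lag_equiv_def eventually_sequentially)
  \<comment> \<open>The summand \<open>nat \<bar>k\<bar>\<close> ensures n - k \<ge> N, so that
    \<open>m\<close> meets the bound and \<open>nat\<close> does not truncate.\<close>
  define n where "n = max K (N + nat \<bar>k\<bar>)"
  define m where "m = nat (int n - k)"
  have nm: "n \<ge> N" "m \<ge> N" "k = int n - int m"
    by (auto simp: n_def m_def)
  have "x !! (n + i) = y !! (m + i)" for i
  proof -
    have "nat (int (n + i) - k) = m + i" using nm by simp
    then show ?thesis using K[of "n + i"] by (simp add: n_def)
  qed
  then show "\<exists>n m. n \<ge> N \<and> m \<ge> N \<and> k = int n - int m \<and> sdrop n x = sdrop m y"
    using nm by (auto simp: sdrop_eq_iff)
next
  assume "\<exists>n m. n \<ge> N \<and> m \<ge> N \<and> k = int n - int m \<and> sdrop n x = sdrop m y"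
  then obtain n m where k: "k = int n - int m" and *: "\<And>i. x !! (n + i) = y !! (m + i)"
    by (auto simp: sdrop_eq_iff)
  have "x !! i = y !! nat (int i - k)" if "n \<le> i" for i
  proof -
    from that obtain j where "i = n + j" using le_Suc_ex by blast
    moreover from this have "nat (int i - k) = m + j" using k by simp
    ultimately show ?thesis using * by simp
  qed
  then show "lag_equiv x k y"
    by (auto simp: lag_equiv_def eventually_sequentially)
qed

text \<open>A cylinder described by a centre and two cut positions instead of two finite paths. All
  its conditions compare edges at given positions, so they can be followed through a block code
  without mentioning ranges.\<close>

definition path_nbhd ::
  "('a, 'b) pre_digraph \<Rightarrow> 'b stream \<Rightarrow> 'b stream \<Rightarrow> nat \<Rightarrow> nat \<Rightarrow> ('b stream \<times> int \<times> 'b stream) set"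
  where
  "path_nbhd E x y n m =
    {(x', int n - int m, y') | x' y'. x' \<in> infinite_paths E \<and> y' \<in> infinite_paths E \<and>
       stake n x' = stake n x \<and> stake m y' = stake m y \<and> sdrop n x' = sdrop m y'}"

lemma arrows_path_groupoid:
  "arrows (path_groupoid E) =
    {(x, k, y). x \<in> infinite_paths E \<and> y \<in> infinite_paths E \<and> lag_equiv x k y}"
  by (simp add: path_groupoid_def Let_def)

text \<open>The lengths are positive so that the common range is determined by the initial segments.\<close>

lemma path_nbhd_eq_cylinder:
  assumes "wf_digraph E" and x: "x \<in> infinite_paths E" and y: "y \<in> infinite_paths E"
    and eq: "sdrop (Suc n) x = sdrop (Suc m) y"
  shows "\<exists>\<alpha> \<beta>. \<alpha> \<in> finite_paths E \<and> \<beta> \<in> finite_paths E \<and> path_range E \<alpha> = path_range E \<beta> \<and>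
    path_nbhd E x y (Suc n) (Suc m) = cylinder E \<alpha> \<beta>"
proof -
  interpret wf_digraph E by fact
  define w where "w = tail E (shd (sdrop (Suc n) x))"
  define p where "p = stake (Suc n) x"
  define q where "q = stake (Suc m) y"
  let ?\<alpha> = "(tail E (shd x), p)" and ?\<beta> = "(tail E (shd y), q)"
  have ax: "awalk (tail E (shd x)) p w" and ay: "awalk (tail E (shd y)) q w"
    unfolding w_def p_def q_def using stake_awalk[OF assms(1)] x y eq by metis+
  have rng: "path_range E ?\<alpha> = w" "path_range E ?\<beta> = w"
    using ax ay by (auto simp: path_range_def)
  have "path_nbhd E x y (Suc n) (Suc m) = cylinder E ?\<alpha> ?\<beta>"
  proof (intro equalityI subsetI)
    fix g assume "g \<in> path_nbhd E x y (Suc n) (Suc m)"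
    then obtain x' y' where g: "g = (x', int (Suc n) - int (Suc m), y')"
      and x': "x' \<in> infinite_paths E" and px: "stake (Suc n) x' = p"
      and py: "stake (Suc m) y' = q" and sd: "sdrop (Suc n) x' = sdrop (Suc m) y'"
      by (auto simp: path_nbhd_def p_def q_def simp del: stake.simps sdrop.simps)
    have "x' !! n = x !! n"
      using px unfolding p_def stake_eq_iff by simp
    then have "tail E (x' !! Suc n) = tail E (x !! Suc n)"
      using x x' unfolding infinite_paths_def mem_Collect_eq by metis
    then have "tail E (shd (sdrop (Suc n) x')) = w"
      by (simp only: w_def sdrop_simps(1))
    moreover have "x' = p @- sdrop (Suc n) x'" "y' = q @- sdrop (Suc n) x'"
      unfolding sd using px py stake_sdrop sd by metis+
    ultimately show "g \<in> cylinder E ?\<alpha> ?\<beta>"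
      unfolding cylinder_def g mem_Collect_eq rng
      using sdrop_infinite_path[OF x', of "Suc n"]
      by (intro exI[of _ "sdrop (Suc n) x'"])
        (auto simp: path_length_def p_def q_def simp del: stake.simps sdrop.simps)
  next
    fix g assume "g \<in> cylinder E ?\<alpha> ?\<beta>"
    then obtain z where z: "z \<in> infinite_paths E" "tail E (shd z) = w"
      and g: "g = (p @- z, int (Suc n) - int (Suc m), q @- z)"
      unfolding cylinder_def rng by (auto simp: path_length_def p_def q_def)
    have "p @- z \<in> infinite_paths E" "q @- z \<in> infinite_paths E"
      using shift_infinite_path[OF assms(1) z(1)] ax ay z(2) by blast+
    moreover have len: "length p = Suc n" "length q = Suc m"
      by (simp_all add: p_def q_def)
    moreover from len have "stake (Suc n) (p @- z) = p" "stake (Suc m) (q @- z) = q"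
      "sdrop (Suc n) (p @- z) = z" "sdrop (Suc m) (q @- z) = z"
      by (simp_all add: stake_shift sdrop_shift del: stake.simps(2) sdrop.simps(2))
    ultimately show "g \<in> path_nbhd E x y (Suc n) (Suc m)"
      unfolding path_nbhd_def g p_def[symmetric] q_def[symmetric] mem_Collect_eq
      by (intro exI[of _ "p @- z"] exI[of _ "q @- z"])
        (simp del: stake.simps sdrop.simps)
  qed
  moreover have "?\<alpha> \<in> finite_paths E" "?\<beta> \<in> finite_paths E"
    using ax ay by (auto simp only: finite_paths_def mem_Collect_eq case_prod_conv)
  moreover have "path_range E ?\<alpha> = path_range E ?\<beta>"
    using rng by simp
  ultimately show ?thesis
    by (intro exI conjI)
qed

lemma openin_path_nbhd:
  assumes "wf_digraph E" "x \<in> infinite_paths E" "y \<in> infinite_paths E"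
    and "sdrop (Suc n) x = sdrop (Suc m) y"
  shows "openin (gtopology (path_groupoid E)) (path_nbhd E x y (Suc n) (Suc m))"
  using path_nbhd_eq_cylinder[OF assms]
  by (auto simp: path_groupoid_def Let_def intro!: topology_generated_by_Basis)

text \<open>The cuts \<open>n\<close>, \<open>m\<close> and the lengths of \<alpha>, \<beta> have
  the same difference \<open>k\<close>. Between the short cut and the long one, \<open>x'\<close>
  and \<open>y'\<close> copy \<open>x\<close> and \<open>y\<close>, which agree there by membership
  in the cylinder; past the long cut they agree by choice.\<close>

lemma path_nbhd_subset_cylinder:
  assumes C: "(x, k, y) \<in> cylinder E \<alpha> \<beta>"
    and n: "n > path_length \<alpha>" and m: "m > path_length \<beta>" and k: "k = int n - int m"
  shows "path_nbhd E x y n m \<subseteq> cylinder E \<alpha> \<beta>"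
proof
  fix g assume "g \<in> path_nbhd E x y n m"
  then obtain x' y' where g: "g = (x', k, y')" and x': "x' \<in> infinite_paths E"
    and sx: "\<And>i. i < n \<Longrightarrow> x' !! i = x !! i" and sy: "\<And>i. i < m \<Longrightarrow> y' !! i = y !! i"
    and sd: "\<And>i. x' !! (n + i) = y' !! (m + i)"
    by (auto simp: path_nbhd_def stake_eq_iff sdrop_eq_iff k)
  define a where "a = path_length \<alpha>"
  define b where "b = path_length \<beta>"
  have len: "length (snd \<alpha>) = a" "length (snd \<beta>) = b"
    by (auto simp: a_def b_def path_length_def split: prod.splits)
  from C obtain z where z: "tail E (shd z) = path_range E \<alpha>"
    and x: "x = snd \<alpha> @- z" and y: "y = snd \<beta> @- z" and k': "k = int a - int b"
    by (auto simp: cylinder_def a_def b_def)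
  have an: "a < n" and bm: "b < m" using n m by (auto simp: a_def b_def)
  have xz: "x !! (a + i) = z !! i" and yz: "y !! (b + i) = z !! i" for i
    using len by (simp_all add: x y shift_snth_ge)
  have "sdrop a x' = sdrop b y'"
    unfolding sdrop_eq_iff
  proof
    fix i
    show "x' !! (a + i) = y' !! (b + i)"
    proof (cases "a + i < n")
      case True
      moreover from this have "b + i < m" using k k' by simp
      ultimately show ?thesis using sx sy xz yz by simp
    next
      case False
      then obtain j where "a + i = n + j" using le_Suc_ex by (metis not_less)
      moreover from this have "b + i = m + j" using k k' by linarith
      ultimately show ?thesis using sd by simp
    qed
  qed
  moreover have "stake a x' = snd \<alpha>" "stake b y' = snd \<beta>"
  proof -
    have "stake a x' = stake a x" "stake b y' = stake b y"
      unfolding stake_eq_iff using sx sy an bm by auto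
    then show "stake a x' = snd \<alpha>" "stake b y' = snd \<beta>"
      using len by (simp_all add: x y stake_shift)
  qed
  \<comment> \<open>As \<open>a < n\<close> is strict, the edge at position \<open>a\<close> is
    still copied from \<open>x\<close>, hence starts at the range of \<alpha>.\<close>
  moreover have "tail E (shd (sdrop a x')) = path_range E \<alpha>"
    using sx[OF an] xz[of 0] z by (simp add: sdrop_simps)
  ultimately show "g \<in> cylinder E \<alpha> \<beta>"
    unfolding cylinder_def g mem_Collect_eq
    using sdrop_infinite_path[OF x', of a] stake_sdrop[of a x'] stake_sdrop[of b y'] k'
    by (intro exI[of _ "sdrop a x'"]) (auto simp: a_def b_def)
qed


section \<open>Sliding block codes\<close>

definition block_code :: "('b \<Rightarrow> 'b \<Rightarrow> 'c) \<Rightarrow> 'b stream \<Rightarrow> 'c stream" where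
  "block_code c x = smap2 c x (stl x)"

lemma snth_block_code [simp]: "block_code c x !! i = c (x !! i) (x !! Suc i)"
  by (simp add: block_code_def)

lemma sdrop_block_code: "sdrop n (block_code c x) = block_code c (sdrop n x)"
  by (rule snth_equalityI) (simp add: sdrop_snth del: snth.simps)

text \<open>The code looks one edge ahead, so one edge of agreement is lost.\<close>

lemma stake_block_code_cong:
  "stake (Suc n) x = stake (Suc n) y \<Longrightarrow> stake n (block_code c x) = stake n (block_code c y)"
  unfolding stake_eq_iff by (simp del: snth.simps)

definition arrow_map :: "('b stream \<Rightarrow> 'c stream) \<Rightarrow> 'b stream \<times> int \<times> 'b stream \<Rightarrow>
    'c stream \<times> int \<times> 'c stream" where
  "arrow_map h = (\<lambda>(x, k, y). (h x, k, h y))"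

lemma lag_equiv_block_code:
  "lag_equiv x k y \<Longrightarrow> lag_equiv (block_code c x) k (block_code c y)"
  unfolding lag_equiv_iff_sdrop[where N = 0] sdrop_block_code by metis

lemma arrow_map_block_code_in_arrows:
  assumes "block_code c ` infinite_paths E \<subseteq> infinite_paths F"
  shows "arrow_map (block_code c) ` arrows (path_groupoid E) \<subseteq> arrows (path_groupoid F)"
  using assms by (auto simp: arrows_path_groupoid arrow_map_def intro: lag_equiv_block_code)

text \<open>Preimages of cylinders are open because each of their arrows has a
  \<open>path_nbhd\<close> with cuts \<open>Suc n\<close>, \<open>Suc m\<close> that is mapped into
  the \<open>path_nbhd\<close> of the image arrow with cuts \<open>n\<close>, \<open>m\<close>. The
  extra edge on either side pays for the lookahead.\<close>

lemma continuous_map_arrow_map_block_code: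
  assumes E: "wf_digraph E" and F: "wf_digraph F"
    and h: "block_code c ` infinite_paths E \<subseteq> infinite_paths F"
  shows "continuous_map (gtopology (path_groupoid E)) (gtopology (path_groupoid F))
    (arrow_map (block_code c))"
proof -
  let ?f = "arrow_map (block_code c)"
  let ?T = "gtopology (path_groupoid E)"
  let ?S = "{cylinder F \<alpha> \<beta> | \<alpha> \<beta>. \<alpha> \<in> finite_paths F \<and> \<beta> \<in> finite_paths F \<and>
               path_range F \<alpha> = path_range F \<beta>}"
  have top: "gtopology (path_groupoid F) = topology_generated_by ?S"
    by (simp add: path_groupoid_def Let_def)
  show ?thesis
    unfolding top
  proof (rule continuous_on_generated_topo)
    show "?f ` topspace ?T \<subseteq> \<Union> ?S"
      using arrow_map_block_code_in_arrows[OF h] topspace_path_groupoid[OF F]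
      by (simp add: topspace_path_groupoid[OF E] top topology_generated_by_topspace)
  next
    fix C assume "C \<in> ?S"
    then obtain \<alpha> \<beta> where C: "C = cylinder F \<alpha> \<beta>" by blast
    show "openin ?T (?f -` C \<inter> topspace ?T)"
    proof (subst openin_subopen, intro ballI)
      fix g assume g: "g \<in> ?f -` C \<inter> topspace ?T"
      then obtain x k y where gxy: "g = (x, k, y)"
        and x: "x \<in> infinite_paths E" and y: "y \<in> infinite_paths E" and l: "lag_equiv x k y"
        by (auto simp: topspace_path_groupoid[OF E] arrows_path_groupoid)
      have hC: "(block_code c x, k, block_code c y) \<in> cylinder F \<alpha> \<beta>"
        using g by (simp add: C gxy arrow_map_def)
      \<comment> \<open>Cuts beyond this bound exceed both path lengths, as
        \<open>path_nbhd_subset_cylinder\<close> demands.\<close>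
      define N where "N = Suc (path_length \<alpha> + path_length \<beta>)"
      obtain n m where nm: "n \<ge> N" "m \<ge> N" and k: "k = int n - int m"
        and sd: "sdrop n x = sdrop m y"
        using l unfolding lag_equiv_iff_sdrop[where N = N] by blast
      have n: "n > path_length \<alpha>" and m: "m > path_length \<beta>"
        using nm by (simp_all add: N_def)
      have sd': "sdrop (Suc n) x = sdrop (Suc m) y"
        using sd unfolding sdrop_simps(2)[symmetric] by (rule arg_cong)
      let ?U = "path_nbhd E x y (Suc n) (Suc m)"
      have op: "openin ?T ?U" by (rule openin_path_nbhd[OF E x y sd'])
      have "?f u \<in> C" if u: "u \<in> ?U" for u
      proof -
        obtain x' y' where u_eq: "u = (x', k, y')"
          and x': "x' \<in> infinite_paths E" and y': "y' \<in> infinite_paths E"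
          and st: "stake (Suc n) x' = stake (Suc n) x" "stake (Suc m) y' = stake (Suc m) y"
          and sdu: "sdrop (Suc n) x' = sdrop (Suc m) y'"
          using u by (auto simp: path_nbhd_def k simp del: stake.simps sdrop.simps)
        \<comment> \<open>Membership in \<open>?U\<close> equates the tails only from
          \<open>Suc n\<close> and \<open>Suc m\<close> on. The edges one place earlier lie in the
          prescribed prefixes, and those of \<open>x\<close> and \<open>y\<close> coincide since
          their tails already agree from \<open>n\<close> and \<open>m\<close>.\<close>
        have "x' !! n = y' !! m"
        proof -
          have "x' !! n = x !! n" "y' !! m = y !! m"
            using st unfolding stake_eq_iff by blast+
          moreover have "x !! n = y !! m"
            using sd unfolding sdrop_eq_iff by (metis add.right_neutral)
          ultimately show ?thesis by simp
        qed
        then have "sdrop n x' = sdrop m y'"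
          using sdu by (intro stream.expand) (simp only: sdrop_simps)
        then have "?f u \<in> path_nbhd F (block_code c x) (block_code c y) n m"
          using h x' y' stake_block_code_cong[OF st(1), of c] stake_block_code_cong[OF st(2), of c]
          unfolding path_nbhd_def u_eq arrow_map_def k
          by (auto simp: sdrop_block_code)
        then show ?thesis
          using path_nbhd_subset_cylinder[OF hC n m k] C by blast
      qed
      moreover have "g \<in> ?U"
        using x y sd' by (auto simp: path_nbhd_def gxy k)
      ultimately show "\<exists>U. openin ?T U \<and> g \<in> U \<and> U \<subseteq> ?f -` C \<inter> topspace ?T"
        using op openin_subset[OF op] by (intro exI[of _ ?U]) blast
    qed
  qed
qed

theorem isomorphic_path_groupoids_block_code:
  assumes E: "wf_digraph E" and F: "wf_digraph F"
    and c: "block_code c ` infinite_paths E \<subseteq> infinite_paths F"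
    and d: "block_code d ` infinite_paths F \<subseteq> infinite_paths E"
    and dc: "\<And>x. x \<in> infinite_paths E \<Longrightarrow> block_code d (block_code c x) = x"
    and cd: "\<And>y. y \<in> infinite_paths F \<Longrightarrow> block_code c (block_code d y) = y"
  shows "isomorphic_top_groupoids (path_groupoid E) (path_groupoid F)"
proof -
  let ?f = "arrow_map (block_code c)" and ?g = "arrow_map (block_code d)"
  let ?G = "path_groupoid E" and ?H = "path_groupoid F"
  have gf: "?g (?f a) = a" if "a \<in> arrows ?G" for a
    using that dc by (auto simp: arrows_path_groupoid arrow_map_def)
  have fg: "?f (?g b) = b" if "b \<in> arrows ?H" for b
    using that cd by (auto simp: arrows_path_groupoid arrow_map_def)
  have fG: "?f ` arrows ?G \<subseteq> arrows ?H" and gH: "?g ` arrows ?H \<subseteq> arrows ?G"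
    by (rule arrow_map_block_code_in_arrows[OF c], rule arrow_map_block_code_in_arrows[OF d])
  have comp: "composable (path_groupoid X) =
      {(a, b). a \<in> arrows (path_groupoid X) \<and> b \<in> arrows (path_groupoid X) \<and>
        snd (snd a) = fst b}" for X :: "('x, 'y) pre_digraph"
    by (auto simp: path_groupoid_def Let_def)
  \<comment> \<open>Composability is equality of the middle paths; reflecting it from the images
    back to the arrows requires injectivity.\<close>
  have inj: "block_code c x = block_code c y \<longleftrightarrow> x = y"
    if "x \<in> infinite_paths E" "y \<in> infinite_paths E" for x y
    using dc that by metis
  have "homeomorphic_map (gtopology ?G) (gtopology ?H) ?f"
    unfolding homeomorphic_map_maps homeomorphic_maps_def
    using continuous_map_arrow_map_block_code[OF E F c]
      continuous_map_arrow_map_block_code[OF F E d] gf fg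
    by (auto simp: topspace_path_groupoid[OF E] topspace_path_groupoid[OF F])
  moreover have "bij_betw ?f (arrows ?G) (arrows ?H)"
    using gf fg fG gH by (intro bij_betw_byWitness[of _ ?g]) auto
  moreover have "(a, b) \<in> composable ?G \<longleftrightarrow> (?f a, ?f b) \<in> composable ?H"
    if "a \<in> arrows ?G" "b \<in> arrows ?G" for a b
  proof -
    have "?f a \<in> arrows ?H" "?f b \<in> arrows ?H" using fG that by auto
    moreover have "snd (snd (?f a)) = fst (?f b) \<longleftrightarrow> snd (snd a) = fst b"
      using that inj by (auto simp: arrows_path_groupoid arrow_map_def)
    ultimately show ?thesis using that by (simp add: comp)
  qed
  moreover have "?f (gmult ?G a b) = gmult ?H (?f a) (?f b)" "?f (ginv ?G a) = ginv ?H (?f a)" for a b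
    by (auto simp: path_groupoid_def Let_def arrow_map_def split: prod.splits)
  ultimately show ?thesis
    unfolding isomorphic_top_groupoids_def top_groupoid_isomorphism_def by blast
qed


section \<open>The block codes of an explosion\<close>

text \<open>The vertex at which every lift of the edge \<open>e\<close> to the explosion starts. For
  edges leaving \<open>v\<close>, the final branch is the case of \<open>M2\<close>.\<close>

definition exploded_tail :: "('a, 'b) pre_digraph \<Rightarrow> 'a \<Rightarrow> 'b set \<Rightarrow> 'b \<Rightarrow> 'a exploded_vertex" where
  "exploded_tail E v M1 e =
    (if tail E e \<noteq> v then Old (tail E e) else if e \<in> M1 then Copy1 else Copy2)"

text \<open>If \<open>e\<close> ends at \<open>v\<close>, it has lifts to both copies, so one of
  them ends where the lifts of \<open>f\<close> start.\<close>

lemma explode_arc: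
  assumes "out_arcs E v = M1 \<union> M2"
    and "e \<in> arcs E" "f \<in> arcs E" "head E e = tail E f"
  shows "(exploded_tail E v M1 e, e, exploded_tail E v M1 f) \<in> arcs (explosion E v M1 M2)"
proof -
  have "e \<in> M1 \<or> e \<in> M2" if "tail E e = v"
    using assms that by (auto simp: out_arcs_def)
  then show ?thesis
    using assms(2-) by (auto simp: explosion_def exploded_tail_def)
qed

text \<open>Disjointness of \<open>M1\<close> and \<open>M2\<close> is what lets \<open>e\<close>
  alone determine the source of its lifts. The case expression collapses both copies to
  \<open>v\<close>.\<close>

lemma explosion_arcD:
  assumes M: "out_arcs E v = M1 \<union> M2" "M1 \<inter> M2 = {}"
    and "(u, e, w) \<in> arcs (explosion E v M1 M2)"
  shows "e \<in> arcs E" "u = exploded_tail E v M1 e"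
    "head E e = (case w of Old z \<Rightarrow> z | _ \<Rightarrow> v)"
proof -
  have *: "f \<in> arcs E \<and> tail E f = v" if "f \<in> M1 \<or> f \<in> M2" for f
    using M(1) that by (auto simp: out_arcs_def)
  show "e \<in> arcs E" "u = exploded_tail E v M1 e" "head E e = (case w of Old z \<Rightarrow> z | _ \<Rightarrow> v)"
    using assms(3) * M(2) by (auto simp: explosion_def exploded_tail_def)
qed

theorem proposition6p7:
  fixes E :: "('a, 'b) pre_digraph"
    and v :: 'a
    and M1 M2 :: "'b set"
  assumes "countable_connected_graph E"
    and "row_finite E"
    and "v \<in> verts E"
    and "card (out_arcs E v) > 1"
    and "out_arcs E v = M1 \<union> M2"
    and "M1 \<inter> M2 = {}"
    and "M1 \<noteq> {}"
    and "M2 \<noteq> {}"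
  shows "isomorphic_top_groupoids (path_groupoid E) (path_groupoid (explosion E v M1 M2))"
proof -
  interpret countable_connected_graph E by fact
  let ?F = "explosion E v M1 M2"
  let ?t = "exploded_tail E v M1"
  \<comment> \<open>The second argument supplies the range of the lift: it must be the source of the
    next lift.\<close>
  let ?c = "\<lambda>e f. (?t e, e, ?t f)"
  \<comment> \<open>Forgetting copies needs no lookahead; the dummy argument gives it the form of a
    block code.\<close>
  let ?d = "\<lambda>a b. fst (snd a)"
  interpret F: nomulti_digraph ?F
    using nomulti_digraph_explosion[OF nomulti_digraph_axioms] assms(5,6) by simp
  have th: "tail ?F (u, e, w) = u" "head ?F (u, e, w) = w" for u e w
    by (simp_all add: explosion_def)
  have code: "block_code ?c x \<in> infinite_paths ?F" if "x \<in> infinite_paths E" for x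
    using that explode_arc[OF assms(5)]
    by (simp add: infinite_paths_def th del: snth.simps)
  \<comment> \<open>Uniqueness of lifts of infinite paths: each arc ends where the next one starts,
    and that vertex is determined by the next edge of \<open>E\<close>.\<close>
  have F_path: "\<exists>u e w e' w'. y !! i = (u, e, w) \<and> y !! Suc i = (w, e', w') \<and>
      e \<in> arcs E \<and> u = ?t e \<and> w = ?t e' \<and> head E e = tail E e'"
    if "y \<in> infinite_paths ?F" for y i
  proof -
    obtain u e w u' e' w' where y: "y !! i = (u, e, w)" "y !! Suc i = (u', e', w')"
      using prod_cases3 by metis
    have a: "(u, e, w) \<in> arcs ?F" "(u', e', w') \<in> arcs ?F" and "head ?F (y !! i) = tail ?F (y !! Suc i)"
      using that y unfolding infinite_paths_def mem_Collect_eq by metis+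
    then have "u' = w" by (simp add: y th del: snth.simps)
    moreover note explosion_arcD[OF assms(5,6) a(1)] explosion_arcD(2)[OF assms(5,6) a(2)]
    \<comment> \<open>Collapsing the copies in \<open>w = ?t e'\<close> yields
      \<open>tail E e'\<close>, which gives \<open>head E e = tail E e'\<close>.\<close>
    ultimately show ?thesis
      using y by (auto simp: exploded_tail_def simp del: snth.simps)
  qed
  have decode: "block_code ?d y \<in> infinite_paths E" if "y \<in> infinite_paths ?F" for y
    unfolding infinite_paths_def mem_Collect_eq
  proof
    fix i
    show "block_code ?d y !! i \<in> arcs E \<and>
        head E (block_code ?d y !! i) = tail E (block_code ?d y !! Suc i)"
      using F_path[OF that, of i] by (auto simp del: snth.simps)
  qed
  have "block_code ?c (block_code ?d y) = y" if "y \<in> infinite_paths ?F" for y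
  proof (rule snth_equalityI)
    fix i
    show "block_code ?c (block_code ?d y) !! i = y !! i"
      using F_path[OF that, of i] by (auto simp del: snth.simps)
  qed
  moreover have "block_code ?d (block_code ?c x) = x" for x
    by (rule snth_equalityI) (simp del: snth.simps)
  ultimately show ?thesis
    using code decode
    by (intro isomorphic_path_groupoids_block_code[OF wf_digraph_axioms F.wf_digraph_axioms])
      auto
qed

end
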